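(* Let $\{x_{ji}:i=1,\ldots,n_j\}\subset\mathbb{R}^p$, $j=1,2,3$, be three samples, $n_j\ge1$, $N=n_1+n_2+n_3$; let $\lambda\ge0$, $\gamma\ge0$, $\rho^0\in(0,1)$, and let current estimates $\rho^{(t)}\in(0,1)$, $\beta^{(t)}=(\beta_0^{(t)},\beta_1^{(t)T})^T\in\mathbb{R}^{1+p}$ be given, with $\mathrm{E}^{(t)}u_{ji}$, $\kappa_Q^{(t)}(\rho,\beta,\alpha)$ and $\mathrm{pQ}^{(t)}(\rho,\beta)$ as defined in the context. Let $$\rho^{(t+1)}=\frac{n_3^{-1}\sum_{i=1}^{n_3}\mathrm{E}^{(t)}u_{3i}+\gamma\rho^0}{1+\gamma},\qquad \alpha^{(t+1)}=\frac1N\sum_{j=1}^3\sum_{i=1}^{n_j}\mathrm{E}^{(t)}u_{ji}.$$ Then $\beta^{(t+1)}$ is a local (respectively global) maximizer of $\beta\mapsto\kappa_Q^{(t)}(\rho^{(t+1)},\beta,\alpha^{(t+1)})$ if and only if $(\rho^{(t+1)},\beta^{(t+1)})$ is a local (respectively global) maximizer of $(\rho,\beta)\mapsto\mathrm{pQ}^{(t)}(\rho,\beta)$.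
   Context: Notation: $\rho_1=0$, $\rho_2=1$, $\rho_3=\rho\in(0,1)$, similarly $\rho^{(t)}_1=0$, $\rho_2^{(t)}=1$, $\rho_3^{(t)}=\rho^{(t)}$; $\beta=(\beta_0,\beta_1^T)^T\in\mathbb{R}^{1+p}$; convention $0\log 0=0$. The penalty is $$\mathrm{pen}(\rho,\beta)=-\lambda\|\beta_1\|_2^2+\gamma(1-\rho^0)(n_3/N)\log(1-\rho)+\gamma\rho^0(n_3/N)\log\rho.$$ Define $$\mathrm{E}^{(t)}u_{ji}=\frac{\rho_j^{(t)}\exp(\beta_0^{(t)}+\beta_1^{(t)T}x_{ji})}{1-\rho_j^{(t)}+\rho_j^{(t)}\exp(\beta_0^{(t)}+\beta_1^{(t)T}x_{ji})}$$ (so $\mathrm{E}^{(t)}u_{1i}=0$ and $\mathrm{E}^{(t)}u_{2i}=1$). The expected augmented objective is $$Q^{(t)}(\rho,\beta,G_0)=\frac1N\sum_{j=1}^3\sum_{i=1}^{n_j}\Big[(1-\mathrm{E}^{(t)}u_{ji})\log\{(1-\rho_j)G_0(\{x_{ji}\})\}+\mathrm{E}^{(t)}u_{ji}\log\{\rho_j\exp(\beta_0+\beta_1^Tx_{ji})G_0(\{x_{ji}\})\}\Big]+\mathrm{pen}(\rho,\beta),$$ and $\mathrm{pQ}^{(t)}(\rho,\beta)=\max_{G_0}Q^{(t)}(\rho,\beta,G_0)$, the maximum being over all probability measures $G_0$ supported on the pooled data $\{x_{ji}:i=1,\ldots,n_j,\,j=1,2,3\}$ with $\int\exp(\beta_0+\beta_1^Tx)\,dG_0=1$.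 Finally, for $\alpha\in(0,1)$, $$\kappa_Q^{(t)}(\rho,\beta,\alpha)=\frac1N\sum_{j=1}^3\sum_{i=1}^{n_j}\Big[(1-\mathrm{E}^{(t)}u_{ji})\log\Big\{\frac{1-\rho_j}{1-\alpha+\alpha\exp(\beta_0+\beta_1^Tx_{ji})}\Big\}+\mathrm{E}^{(t)}u_{ji}\log\Big\{\frac{\rho_j\exp(\beta_0+\beta_1^Tx_{ji})}{1-\alpha+\alpha\exp(\beta_0+\beta_1^Tx_{ji})}\Big\}\Big]-\log N+\mathrm{pen}(\rho,\beta).$$ *)

theory Defs
  imports "HOL-Probability.Probability"
begin

text \<open>
  The data are \<open>x j i\<close> for \<open>j \<in> {1..3}\<close>, \<open>i \<in> {1..n j}\<close>; values of \<open>n\<close> and \<open>x\<close> outside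
  these ranges are irrelevant. A parameter \<open>\<beta> = (\<beta>\<^sub>0, \<beta>\<^sub>1)\<close> is a pair, carrying the usual
  topology of the product.
\<close>

definition total :: "(nat \<Rightarrow> nat) \<Rightarrow> nat" where
  "total n = (\<Sum>j\<in>{1..3}. n j)"

definition pooled :: "(nat \<Rightarrow> nat) \<Rightarrow> (nat \<Rightarrow> nat \<Rightarrow> real ^ 'p) \<Rightarrow> (real ^ 'p) set" where
  "pooled n x = {x j i | j i. j \<in> {1..3} \<and> i \<in> {1..n j}}"

definition mix :: "real \<Rightarrow> nat \<Rightarrow> real" where
  "mix \<rho> j = (if j = 1 then 0 else if j = 2 then 1 else \<rho>)"

definition tilt :: "real \<times> (real ^ 'p) \<Rightarrow> real ^ 'p \<Rightarrow> real" where
  "tilt \<beta> v = exp (fst \<beta> + snd \<beta> \<bullet> v)"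

definition Eu :: "real \<Rightarrow> real \<times> (real ^ 'p) \<Rightarrow> (nat \<Rightarrow> nat \<Rightarrow> real ^ 'p) \<Rightarrow> nat \<Rightarrow> nat \<Rightarrow> real" where
  "Eu \<rho>t \<beta>t x j i =
     mix \<rho>t j * tilt \<beta>t (x j i) / (1 - mix \<rho>t j + mix \<rho>t j * tilt \<beta>t (x j i))"

definition pen :: "(nat \<Rightarrow> nat) \<Rightarrow> real \<Rightarrow> real \<Rightarrow> real \<Rightarrow> real \<Rightarrow> real \<times> (real ^ 'p) \<Rightarrow> real" where
  "pen n lam gam rho0 \<rho> \<beta> =
     - lam * (norm (snd \<beta>))\<^sup>2
     + gam * (1 - rho0) * (real (n 3) / real (total n)) * ln (1 - \<rho>)
     + gam * rho0 * (real (n 3) / real (total n)) * ln \<rho>"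

text \<open>
  The logarithm with \<open>log 0 = -\<infinity>\<close>. The convention \<open>0 log 0 = 0\<close> is then
  multiplication on \<^typ>\<open>ereal\<close>, where \<open>0 * (-\<infinity>) = 0\<close>.
\<close>

definition elog :: "real \<Rightarrow> ereal" where
  "elog r = (if r \<le> 0 then - \<infinity> else ereal (ln r))"

definition Q :: "(nat \<Rightarrow> nat) \<Rightarrow> (nat \<Rightarrow> nat \<Rightarrow> real ^ 'p) \<Rightarrow> real \<Rightarrow> real \<Rightarrow> real \<Rightarrow>
    real \<Rightarrow> real \<times> (real ^ 'p) \<Rightarrow> real \<Rightarrow> real \<times> (real ^ 'p) \<Rightarrow> (real ^ 'p) pmf \<Rightarrow> ereal" where
  "Q n x lam gam rho0 \<rho>t \<beta>t \<rho> \<beta> G =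
     ereal (1 / real (total n)) *
       (\<Sum>j\<in>{1..3}. \<Sum>i\<in>{1..n j}.
          ereal (1 - Eu \<rho>t \<beta>t x j i) * elog ((1 - mix \<rho> j) * pmf G (x j i))
        + ereal (Eu \<rho>t \<beta>t x j i) * elog (mix \<rho> j * tilt \<beta> (x j i) * pmf G (x j i)))
     + ereal (pen n lam gam rho0 \<rho> \<beta>)"

text \<open>
  A probability measure supported on the finite set of pooled data is a discrete distribution.
\<close>

definition feasible ::
    "(nat \<Rightarrow> nat) \<Rightarrow> (nat \<Rightarrow> nat \<Rightarrow> real ^ 'p) \<Rightarrow> real \<times> (real ^ 'p) \<Rightarrow> (real ^ 'p) pmf set" where
  "feasible n x \<beta> = {G. set_pmf G \<subseteq> pooled n x \<and> measure_pmf.expectation G (tilt \<beta>) = 1}"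

text \<open>
  The supremum is a maximum whenever \<open>feasible n x \<beta>\<close> is nonempty: the feasible weights form a
  compact subset of a finite-dimensional simplex and \<open>Q\<close> is upper semicontinuous in them.
  For some \<open>\<beta>\<close> no feasible distribution exists; \<open>pQ_dom\<close> collects the
  \<open>(\<rho>, \<beta>)\<close> for which the maximum makes sense. Maximizers are sought in this set:
  comparing the values \<open>-\<infinity>\<close> of empty suprema would make every interior point of the
  infeasible region a spurious local maximizer.
\<close>

definition pQ :: "(nat \<Rightarrow> nat) \<Rightarrow> (nat \<Rightarrow> nat \<Rightarrow> real ^ 'p) \<Rightarrow> real \<Rightarrow> real \<Rightarrow> real \<Rightarrow>
    real \<Rightarrow> real \<times> (real ^ 'p) \<Rightarrow> real \<Rightarrow> real \<times> (real ^ 'p) \<Rightarrow> ereal" where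
  "pQ n x lam gam rho0 \<rho>t \<beta>t \<rho> \<beta> =
     (SUP G\<in>feasible n x \<beta>. Q n x lam gam rho0 \<rho>t \<beta>t \<rho> \<beta> G)"

definition pQ_dom ::
    "(nat \<Rightarrow> nat) \<Rightarrow> (nat \<Rightarrow> nat \<Rightarrow> real ^ 'p) \<Rightarrow> (real \<times> (real \<times> (real ^ 'p))) set" where
  "pQ_dom n x = {(\<rho>, \<beta>). \<rho> \<in> {0<..<1} \<and> feasible n x \<beta> \<noteq> {}}"

text \<open>
  For \<open>\<rho>, \<alpha> \<in> (0,1)\<close> the argument of \<^const>\<open>ln\<close> below vanishes only
  when the factor in front of it is \<open>0\<close> (namely for \<open>j = 1, 2\<close>), so real arithmetic
  implements \<open>0 log 0 = 0\<close>.
\<close>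

definition kappaQ :: "(nat \<Rightarrow> nat) \<Rightarrow> (nat \<Rightarrow> nat \<Rightarrow> real ^ 'p) \<Rightarrow> real \<Rightarrow> real \<Rightarrow> real \<Rightarrow>
    real \<Rightarrow> real \<times> (real ^ 'p) \<Rightarrow> real \<Rightarrow> real \<times> (real ^ 'p) \<Rightarrow> real \<Rightarrow> real" where
  "kappaQ n x lam gam rho0 \<rho>t \<beta>t \<rho> \<beta> \<alpha> =
     (1 / real (total n)) *
       (\<Sum>j\<in>{1..3}. \<Sum>i\<in>{1..n j}.
          (1 - Eu \<rho>t \<beta>t x j i) * ln ((1 - mix \<rho> j) / (1 - \<alpha> + \<alpha> * tilt \<beta> (x j i)))
        + Eu \<rho>t \<beta>t x j i *
            ln (mix \<rho> j * tilt \<beta> (x j i) / (1 - \<alpha> + \<alpha> * tilt \<beta> (x j i))))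
     - ln (real (total n)) + pen n lam gam rho0 \<rho> \<beta>"

definition rho_next :: "(nat \<Rightarrow> nat) \<Rightarrow> (nat \<Rightarrow> nat \<Rightarrow> real ^ 'p) \<Rightarrow> real \<Rightarrow> real \<Rightarrow>
    real \<Rightarrow> real \<times> (real ^ 'p) \<Rightarrow> real" where
  "rho_next n x gam rho0 \<rho>t \<beta>t =
     ((1 / real (n 3)) * (\<Sum>i\<in>{1..n 3}. Eu \<rho>t \<beta>t x 3 i) + gam * rho0) / (1 + gam)"

definition alpha_next :: "(nat \<Rightarrow> nat) \<Rightarrow> (nat \<Rightarrow> nat \<Rightarrow> real ^ 'p) \<Rightarrow>
    real \<Rightarrow> real \<times> (real ^ 'p) \<Rightarrow> real" where
  "alpha_next n x \<rho>t \<beta>t =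
     (1 / real (total n)) * (\<Sum>j\<in>{1..3}. \<Sum>i\<in>{1..n j}. Eu \<rho>t \<beta>t x j i)"

definition global_maximizer_on :: "'a set \<Rightarrow> ('a \<Rightarrow> 'b::linorder) \<Rightarrow> 'a \<Rightarrow> bool" where
  "global_maximizer_on S f z \<longleftrightarrow> is_arg_max f (\<lambda>y. y \<in> S) z"

definition local_maximizer_on ::
    "('a::topological_space) set \<Rightarrow> ('a \<Rightarrow> 'b::linorder) \<Rightarrow> 'a \<Rightarrow> bool" where
  "local_maximizer_on S f z \<longleftrightarrow> (\<exists>U. open U \<and> z \<in> U \<and> is_arg_max f (\<lambda>y. y \<in> S \<inter> U) z)"

end

theory Submission
  imports Defs
begin

text \<open>
  For fixed \<open>\<beta>\<close>, \<open>Q\<close> splits into a part in \<open>\<rho>\<close>, which is a binary cross entropy with unique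
  maximizer \<open>\<rho>\<^bsup>(t+1)\<^esup>\<close>, and an empirical log-likelihood of \<open>(\<beta>, G)\<close>. By Gibbs' inequality,
  profiling over \<open>G\<close> gives at most \<open>kappaQ\<close> at \<open>\<alpha>\<^bsup>(t+1)\<^esup>\<close>, up to a constant caused by ties in
  the data, with equality where the derivative of \<open>kappaQ\<close> in \<open>\<beta>\<^sub>0\<close> vanishes. This happens at every
  local maximizer of \<open>kappaQ\<close>, and for each \<open>\<beta>\<^sub>1\<close> at some \<open>\<beta>\<^sub>0\<close> maximizing \<open>kappaQ\<close>.
  So local and global maximizers of \<open>kappaQ\<close> carry over to \<open>pQ\<close>. Conversely, since \<open>\<beta>\<^sub>0\<close> is determined
  by \<open>\<beta>\<^sub>1\<close> and \<open>G\<close>, the log-likelihood is a function of \<open>(\<beta>\<^sub>1, log G)\<close>, and as such it is concave;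
  hence a local maximizer of \<open>pQ\<close> is already a global maximizer of \<open>kappaQ\<close>.
\<close>

section \<open>Log-sum-exp: convexity and Lipschitz continuity\<close>

definition lse :: "'a set \<Rightarrow> ('a \<Rightarrow> real) \<Rightarrow> real" where
  "lse P f = ln (\<Sum>v\<in>P. exp (f v))"

lemma sum_exp_pos:
  fixes f :: "'a \<Rightarrow> real"
  assumes "finite P" "P \<noteq> {}"
  shows "(\<Sum>v\<in>P. exp (f v)) > 0"
  using assms by (intro sum_pos) auto

lemma exp_lse:
  assumes "finite P" "P \<noteq> {}"
  shows "exp (lse P f) = (\<Sum>v\<in>P. exp (f v))"
  using sum_exp_pos[OF assms] by (simp add: lse_def)

lemma sum_exp_minus_lse:
  assumes "finite P" "P \<noteq> {}"
  shows "(\<Sum>v\<in>P. exp (f v - lse P f)) = 1"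
  using sum_exp_pos[OF assms, of f]
  by (simp add: exp_diff exp_lse[OF assms] flip: sum_divide_distrib)

lemma exp_convex_combination:
  fixes a b s :: real
  assumes "0 \<le> s" "s \<le> 1"
  shows "exp ((1 - s) * a + s * b) \<le> (1 - s) * exp a + s * exp b"
  using convex_onD[OF exp_convex, of s a b] assms by simp

text \<open>Once the convex combination of the two values is subtracted from the exponents,
  pointwise convexity of \<open>exp\<close> bounds the sum by a combination of two normalized sums,
  each equal to 1.\<close>

lemma lse_convex:
  fixes f g :: "'a \<Rightarrow> real"
  assumes P: "finite P" "P \<noteq> {}" and s: "0 \<le> s" "s \<le> 1"
  shows "lse P (\<lambda>v. (1 - s) * f v + s * g v) \<le> (1 - s) * lse P f + s * lse P g"
proof -
  let ?c = "(1 - s) * lse P f + s * lse P g"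
  have "exp (lse P (\<lambda>v. (1 - s) * f v + s * g v) - ?c)
      = (\<Sum>v\<in>P. exp ((1 - s) * (f v - lse P f) + s * (g v - lse P g)))"
    unfolding exp_diff exp_lse[OF P] sum_divide_distrib
    by (intro sum.cong refl) (simp add: exp_diff[symmetric] algebra_simps)
  also have "\<dots> \<le> (\<Sum>v\<in>P. (1 - s) * exp (f v - lse P f) + s * exp (g v - lse P g))"
    by (intro sum_mono exp_convex_combination s)
  also have "\<dots> = 1"
    by (simp add: sum.distrib sum_exp_minus_lse[OF P] flip: sum_distrib_left)
  finally show ?thesis by simp
qed

text \<open>\<open>lse\<close> is monotone, and a constant added to all exponents passes through it
  unchanged.\<close>

lemma lse_le_add:
  fixes f g :: "'a \<Rightarrow> real"
  assumes P: "finite P" "P \<noteq> {}" and le: "\<And>v. v \<in> P \<Longrightarrow> f v \<le> g v + D"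
  shows "lse P f \<le> lse P g + D"
proof -
  have "exp (lse P f) \<le> (\<Sum>v\<in>P. exp (g v + D))"
    unfolding exp_lse[OF P] by (intro sum_mono) (simp add: le)
  also have "\<dots> = exp (lse P g + D)"
    by (simp add: exp_add exp_lse[OF P] flip: sum_distrib_right)
  finally show ?thesis by simp
qed

lemma lse_lipschitz:
  fixes f g :: "'a \<Rightarrow> real"
  assumes P: "finite P" "P \<noteq> {}" and le: "\<And>v. v \<in> P \<Longrightarrow> \<bar>f v - g v\<bar> \<le> D"
  shows "\<bar>lse P f - lse P g\<bar> \<le> D"
proof -
  have "lse P f \<le> lse P g + D" "lse P g \<le> lse P f + D"
    using le by (intro lse_le_add[OF P]; force simp: abs_le_iff)+
  then show ?thesis by simp
qed

text \<open>The defect is exactly \<open>s * (1 - s) * (norm (a - b))\<^sup>2\<close>.\<close>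

lemma norm_power2_convex:
  fixes a b :: "'a::real_inner"
  assumes "0 \<le> s" "s \<le> 1"
  shows "(norm ((1 - s) *\<^sub>R a + s *\<^sub>R b))\<^sup>2 \<le> (1 - s) * (norm a)\<^sup>2 + s * (norm b)\<^sup>2"
proof -
  have "(1 - s) * (norm a)\<^sup>2 + s * (norm b)\<^sup>2 - (norm ((1 - s) *\<^sub>R a + s *\<^sub>R b))\<^sup>2
      = s * (1 - s) * (norm (a - b))\<^sup>2"
    unfolding power2_norm_eq_inner
    by (simp add: inner_diff_left inner_diff_right inner_add_left inner_add_right
        inner_commute algebra_simps)
  moreover have "\<dots> \<ge> 0" using assms by simp
  ultimately show ?thesis by linarith
qed

section \<open>The empirical log-likelihood, its dual and stationarity in the intercept\<close>

text \<open>Abstracts from the three samples. By \<open>sum_w\<close>, \<alpha> is the mean of the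
  weights, so the intercept \<open>fst \<beta>\<close> enters the log-likelihood with coefficient
  \<open>\<alpha> * card I\<close>.\<close>

locale tilted_sample =
  fixes I :: "'k set" and w :: "'k \<Rightarrow> real" and y :: "'k \<Rightarrow> real ^ 'p" and \<alpha> lam :: real
  assumes finite_I: "finite I" and I_ne: "I \<noteq> {}"
    and \<alpha>_pos: "0 < \<alpha>" and \<alpha>_less_1: "\<alpha> < 1"
    and sum_w: "sum w I = \<alpha> * card I"
    and lam_nonneg: "0 \<le> lam"
begin

text \<open>The feasibility constraints for the atoms of a distribution, restricted to strictly
  positive atoms, where \<open>Q\<close> is finite. Values of \<open>q\<close> off the data are left
  free.\<close>

definition weights :: "real \<times> (real ^ 'p) \<Rightarrow> (real ^ 'p \<Rightarrow> real) \<Rightarrow> bool" where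
  "weights \<beta> q \<longleftrightarrow> (\<forall>v\<in>y ` I. 0 < q v) \<and> (\<Sum>v\<in>y ` I. q v) = 1 \<and>
     (\<Sum>v\<in>y ` I. q v * tilt \<beta> v) = 1"

text \<open>Up to the factor \<open>card I\<close>, this will be the part of \<open>Q\<close> that
  depends on \<open>\<beta>\<close> and on the distribution. It sums over observations, so tied
  points count with multiplicity.\<close>

definition loglik :: "real \<times> (real ^ 'p) \<Rightarrow> (real ^ 'p \<Rightarrow> real) \<Rightarrow> real" where
  "loglik \<beta> q = (\<Sum>k\<in>I. w k * (fst \<beta> + snd \<beta> \<bullet> y k) + ln (q (y k))) - lam * (norm (snd \<beta>))\<^sup>2"

definition den :: "real \<times> (real ^ 'p) \<Rightarrow> real ^ 'p \<Rightarrow> real" where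
  "den \<beta> v = 1 - \<alpha> + \<alpha> * tilt \<beta> v"

definition dual :: "real \<times> (real ^ 'p) \<Rightarrow> real" where
  "dual \<beta> = (\<Sum>k\<in>I. w k * (fst \<beta> + snd \<beta> \<bullet> y k) - ln (den \<beta> (y k))) - lam * (norm (snd \<beta>))\<^sup>2"

definition freq :: "real ^ 'p \<Rightarrow> real" where
  "freq v = card {k\<in>I. y k = v} / card I"

text \<open>Minus \<open>card I\<close> times the Shannon entropy of \<open>freq\<close>. Without
  ties it is \<open>- card I * ln (card I)\<close>, which accounts for the term
  \<open>- ln N\<close> in \<open>kappaQ\<close>; with ties the constants differ.\<close>

definition entropy :: real where
  "entropy = (\<Sum>k\<in>I. ln (freq (y k)))"

text \<open>The derivative of \<open>dual\<close> in \<open>fst \<beta>\<close> vanishes; the common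
  factor \<alpha> is cancelled.\<close>

definition stationary :: "real \<times> (real ^ 'p) \<Rightarrow> bool" where
  "stationary \<beta> \<longleftrightarrow> (\<Sum>k\<in>I. tilt \<beta> (y k) / den \<beta> (y k)) = card I"

lemma tilt_pos: "0 < tilt \<beta> v"
  by (simp add: tilt_def)

lemma den_pos: "0 < den \<beta> v"
  using \<alpha>_pos \<alpha>_less_1 tilt_pos[of \<beta> v] by (auto simp: den_def intro!: add_pos_pos)

lemma card_I_pos: "0 < real (card I)"
  using finite_I I_ne by (simp add: card_gt_0_iff)

lemma finite_P: "finite (y ` I)" and P_ne: "y ` I \<noteq> {}"
  using finite_I I_ne by auto

lemma freq_pos: "v \<in> y ` I \<Longrightarrow> 0 < freq v"
  using finite_I card_I_pos by (auto simp: freq_def card_gt_0_iff intro!: divide_pos_pos)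

lemma sum_sample: "(\<Sum>k\<in>I. f (y k)) = card I * (\<Sum>v\<in>y ` I. freq v * f v)"
  for f :: "real ^ 'p \<Rightarrow> real"
  using sum_fun_comp[OF finite_I finite_P, of y f] card_I_pos
  by (simp add: freq_def sum_distrib_left)

lemma sum_freq: "(\<Sum>v\<in>y ` I. freq v) = 1"
  using sum_sample[of "\<lambda>_. 1"] card_I_pos by simp

text \<open>For weights satisfying both constraints, \<open>q * den \<beta>\<close> is again a probability
  vector, so this is Gibbs' inequality.\<close>

lemma loglik_le_dual:
  assumes "weights \<beta> q"
  shows "loglik \<beta> q \<le> dual \<beta> + entropy"
proof -
  have q: "\<And>v. v \<in> y ` I \<Longrightarrow> 0 < q v" using assms by (auto simp: weights_def)
  let ?r = "\<lambda>v. q v * den \<beta> v / freq v"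
  have mass: "(\<Sum>v\<in>y ` I. q v * den \<beta> v) = 1"
  proof -
    have "(\<Sum>v\<in>y ` I. q v * den \<beta> v)
        = (1 - \<alpha>) * (\<Sum>v\<in>y ` I. q v) + \<alpha> * (\<Sum>v\<in>y ` I. q v * tilt \<beta> v)"
      by (simp add: den_def sum_distrib_left sum.distrib[symmetric] algebra_simps)
    then show ?thesis using assms by (simp add: weights_def)
  qed
  have "ln (?r (y k)) = ln (q (y k)) + ln (den \<beta> (y k)) - ln (freq (y k))" if "k \<in> I" for k
    using q[of "y k"] freq_pos[of "y k"] den_pos[of \<beta> "y k"] that
    by (simp add: ln_mult_pos ln_divide_pos)
  then have "loglik \<beta> q - dual \<beta> - entropy = (\<Sum>k\<in>I. ln (?r (y k)))"
    by (simp add: loglik_def dual_def entropy_def sum_subtractf sum.distrib)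
  also have "\<dots> \<le> (\<Sum>k\<in>I. ?r (y k) - 1)"
    by (intro sum_mono ln_le_minus_one) (simp add: q freq_pos den_pos)
  also have "\<dots> = card I * (\<Sum>v\<in>y ` I. freq v * (?r v - 1))"
    by (rule sum_sample)
  also have "(\<Sum>v\<in>y ` I. freq v * (?r v - 1)) = (\<Sum>v\<in>y ` I. q v * den \<beta> v - freq v)"
    by (intro sum.cong refl) (use freq_pos in \<open>force simp: field_simps\<close>)
  also have "\<dots> = 0" by (simp add: sum_subtractf mass sum_freq)
  finally show ?thesis by simp
qed

text \<open>Equality in Gibbs' inequality requires \<open>q * den \<beta> = freq\<close>. For this
  \<open>q\<close> the tilted constraint is stationarity itself, and total mass one follows from it
  because \<open>\<alpha> < 1\<close>.\<close>

lemma stationary_attains: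
  assumes "stationary \<beta>"
  shows "weights \<beta> (\<lambda>v. freq v / den \<beta> v)" "loglik \<beta> (\<lambda>v. freq v / den \<beta> v) = dual \<beta> + entropy"
proof -
  let ?q = "\<lambda>v. freq v / den \<beta> v"
  have tilted: "(\<Sum>v\<in>y ` I. ?q v * tilt \<beta> v) = 1"
    using assms sum_sample[of "\<lambda>v. tilt \<beta> v / den \<beta> v"] card_I_pos
    by (simp add: stationary_def)
  have "(1 - \<alpha>) * (\<Sum>v\<in>y ` I. ?q v) + \<alpha> * (\<Sum>v\<in>y ` I. ?q v * tilt \<beta> v)
      = (\<Sum>v\<in>y ` I. ?q v * den \<beta> v)"
    by (simp add: den_def sum_distrib_left sum.distrib[symmetric] field_simps)
      (simp add: add_divide_distrib[symmetric] diff_divide_distrib[symmetric] algebra_simps)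
  also have "\<dots> = (\<Sum>v\<in>y ` I. freq v)"
    by (intro sum.cong refl) (use den_pos in \<open>simp add: less_imp_neq[symmetric]\<close>)
  finally have "(1 - \<alpha>) * ((\<Sum>v\<in>y ` I. ?q v) - 1) = 0"
    unfolding tilted sum_freq by (simp add: algebra_simps)
  then have "(\<Sum>v\<in>y ` I. ?q v) = 1" using \<alpha>_less_1 by simp
  with tilted show "weights \<beta> ?q" by (auto simp: weights_def freq_pos den_pos)
  show "loglik \<beta> ?q = dual \<beta> + entropy"
    by (simp add: loglik_def dual_def entropy_def ln_divide_pos freq_pos den_pos
        sum_subtractf sum.distrib cong: sum.cong)
qed

text \<open>Intermediate value theorem in \<open>c = exp b\<close>, which turns the limit of
  \<open>b\<close> at minus infinity into the endpoint \<open>c = 0\<close>, where the sum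
  vanishes.\<close>

lemma stationary_exists: "\<exists>b. stationary (b, \<theta>)"
proof -
  let ?f = "\<lambda>c. \<Sum>k\<in>I. c * exp (\<theta> \<bullet> y k) / (1 - \<alpha> + \<alpha> * (c * exp (\<theta> \<bullet> y k)))"
  \<comment> \<open>At \<open>c = 1 / m\<close> every tilt is at least 1. A tilt
    \<open>t \<ge> 1\<close> satisfies \<open>t \<ge> 1 - \<alpha> + \<alpha> * t\<close>, so every
    summand is then at least 1.\<close>
  define m where "m = Min ((\<lambda>k. exp (\<theta> \<bullet> y k)) ` I)"
  have m_pos: "0 < m" unfolding m_def using finite_I I_ne by (subst Min_gr_iff) auto
  have m_le: "m \<le> exp (\<theta> \<bullet> y k)" if "k \<in> I" for k
    unfolding m_def using finite_I that by (intro Min_le) auto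
  have pos: "0 < 1 - \<alpha> + \<alpha> * (c * exp (\<theta> \<bullet> y k))" if "0 \<le> c" for c k
    using \<alpha>_pos \<alpha>_less_1 that by (intro add_pos_nonneg) auto
  have "\<exists>c\<ge>0. c \<le> 1 / m \<and> ?f c = card I"
  proof (rule IVT')
    show "?f 0 \<le> card I" by simp
    have "1 \<le> (1 / m) * exp (\<theta> \<bullet> y k) / (1 - \<alpha> + \<alpha> * ((1 / m) * exp (\<theta> \<bullet> y k)))" if "k \<in> I" for k
    proof -
      have "1 \<le> (1 / m) * exp (\<theta> \<bullet> y k)" using m_le[OF that] m_pos by simp
      then have "(1 - \<alpha>) * 1 \<le> (1 - \<alpha>) * ((1 / m) * exp (\<theta> \<bullet> y k))"
        using \<alpha>_less_1 by (intro mult_left_mono) auto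
      moreover have "0 < 1 - \<alpha> + \<alpha> * ((1 / m) * exp (\<theta> \<bullet> y k))"
        using pos[of "1 / m" k] m_pos by simp
      ultimately show ?thesis
        by (simp only: le_divide_eq_1_pos left_diff_distrib)
    qed
    then have "(\<Sum>k\<in>I. 1) \<le> ?f (1 / m)" by (intro sum_mono)
    then show "card I \<le> ?f (1 / m)" by simp
    show "continuous_on {0..1 / m} ?f"
      using pos by (intro continuous_intros) (auto simp: less_imp_neq[symmetric])
  qed (use m_pos in auto)
  then obtain c where c: "0 \<le> c" "?f c = card I" by blast
  have "c \<noteq> 0" using c(2) card_I_pos by auto
  with c have "stationary (ln c, \<theta>)"
    by (simp add: stationary_def den_def tilt_def exp_add)
  then show ?thesis by blast
qed

lemma tilt_shift: "tilt (b + c, \<theta>) v = exp c * tilt (b, \<theta>) v"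
  by (simp add: tilt_def exp_add)

text \<open>\<open>ln (den (b, \<theta>) v)\<close> is convex in \<open>b\<close> and so lies above
  its tangent. At a stationary point the tangent slopes sum to
  \<open>\<alpha> * card I = sum w I\<close> and cancel the linear term of
  \<open>dual\<close>.\<close>

lemma stationary_dual_max:
  assumes "stationary (b, \<theta>)"
  shows "dual (b', \<theta>) \<le> dual (b, \<theta>)"
proof -
  define c where "c = b' - b"
  \<comment> \<open>The slope of \<open>ln den\<close> in the intercept: the posterior probability
    of the tilted component under mixing proportion \<alpha>.\<close>
  define p where "p k = \<alpha> * tilt (b, \<theta>) (y k) / den (b, \<theta>) (y k)" for k
  have p01: "0 \<le> p k" "p k \<le> 1" for k
    using \<alpha>_pos \<alpha>_less_1 tilt_pos[of "(b, \<theta>)" "y k"] den_pos[of "(b, \<theta>)" "y k"]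
    by (auto simp: p_def den_def intro!: divide_nonneg_pos)
  have "ln (den (b, \<theta>) (y k)) + p k * c \<le> ln (den (b', \<theta>) (y k))" for k
  proof -
    let ?d = "den (b, \<theta>) (y k)" and ?d' = "den (b', \<theta>) (y k)"
    have "exp (p k * c) \<le> (1 - p k) + p k * exp c"
      using exp_convex_combination[OF p01, of k 0 c] by simp
    also have "\<dots> = ?d' / ?d"
    proof -
      have "tilt (b', \<theta>) (y k) = exp c * tilt (b, \<theta>) (y k)"
        using tilt_shift[of b c] by (simp add: c_def)
      then show ?thesis
        using den_pos[of "(b, \<theta>)" "y k"]
        by (simp add: p_def field_simps) (simp add: den_def algebra_simps)
    qed
    finally have "p k * c \<le> ln (?d' / ?d)"
      using den_pos by (subst ln_ge_iff) auto
    then show ?thesis by (simp add: ln_divide_pos den_pos)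
  qed
  then have "(\<Sum>k\<in>I. ln (den (b, \<theta>) (y k)) + p k * c) \<le> (\<Sum>k\<in>I. ln (den (b', \<theta>) (y k)))"
    by (intro sum_mono)
  moreover have "(\<Sum>k\<in>I. p k) = \<alpha> * card I"
    using assms by (simp add: p_def stationary_def flip: times_divide_eq_right sum_distrib_left)
  moreover have "(\<Sum>k\<in>I. w k * (b' + \<theta> \<bullet> y k)) = (\<Sum>k\<in>I. w k * (b + \<theta> \<bullet> y k)) + sum w I * c"
    by (simp add: c_def sum.distrib distrib_left right_diff_distrib flip: sum_distrib_right)
  ultimately show ?thesis
    by (simp add: dual_def sum_subtractf sum.distrib sum_w flip: sum_distrib_right)
qed

text \<open>Fermat's rule along the intercept direction, with \<open>snd \<beta>\<close> kept
  fixed.\<close>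

lemma local_max_stationary:
  assumes U: "open U" "\<beta> \<in> U" and max: "\<And>z. z \<in> U \<Longrightarrow> dual z \<le> dual \<beta>"
  shows "stationary \<beta>"
proof -
  obtain b \<theta> where \<beta>: "\<beta> = (b, \<theta>)" by fastforce
  let ?D = "(\<Sum>k\<in>I. w k - \<alpha> * tilt \<beta> (y k) / den \<beta> (y k))"
  have "((\<lambda>a. dual (a, \<theta>)) has_real_derivative ?D) (at b)"
    unfolding dual_def den_def tilt_def fst_conv snd_conv
    by (rule derivative_eq_intros refl | use den_pos[unfolded den_def tilt_def] in \<open>force simp: \<beta>\<close>)+
      (simp add: \<beta> mult.commute)
  moreover obtain e where e: "0 < e" "ball \<beta> e \<subseteq> U" using U open_contains_ball by blast
  moreover have "dual (a, \<theta>) \<le> dual (b, \<theta>)" if "\<bar>b - a\<bar> < e" for a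
    using max[of "(a, \<theta>)"] e that by (auto simp: \<beta> dist_Pair_Pair dist_real_def subset_iff)
  ultimately have "?D = 0" by (intro DERIV_local_max[of _ _ b e]) auto
  then have "\<alpha> * (\<Sum>k\<in>I. tilt \<beta> (y k) / den \<beta> (y k)) = \<alpha> * card I"
    by (simp add: sum_subtractf sum_w sum_distrib_left)
  then show ?thesis using \<alpha>_pos by (simp add: stationary_def)
qed

section \<open>Concavity of the log-likelihood in the slope and the log weights\<close>

text \<open>Logarithms of the two constraints. The second determines the intercept from
  \<open>snd \<beta>\<close> and \<open>q\<close>.\<close>

lemma weights_lse:
  assumes "weights \<beta> q"
  shows "lse (y ` I) (\<lambda>v. ln (q v)) = 0"
    and "lse (y ` I) (\<lambda>v. ln (q v) + snd \<beta> \<bullet> v) = - fst \<beta>"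
proof -
  have q: "\<And>v. v \<in> y ` I \<Longrightarrow> exp (ln (q v)) = q v" using assms by (auto simp: weights_def)
  show "lse (y ` I) (\<lambda>v. ln (q v)) = 0"
    using assms by (simp add: lse_def q weights_def cong: sum.cong)
  have "(\<Sum>v\<in>y ` I. exp (ln (q v) + snd \<beta> \<bullet> v)) = (\<Sum>v\<in>y ` I. q v * tilt \<beta> v) / exp (fst \<beta>)"
    by (simp add: exp_add q tilt_def sum_divide_distrib cong: sum.cong)
  then show "lse (y ` I) (\<lambda>v. ln (q v) + snd \<beta> \<bullet> v) = - fst \<beta>"
    using assms by (simp add: lse_def weights_def ln_div)
qed

text \<open>Converse parametrization: normalizing arbitrary exponents \<open>g\<close> and solving
  for the intercept meets both constraints. The log-likelihood becomes linear in
  \<open>(\<theta>, g)\<close> minus convex terms, as 1 - \<alpha>, \<alpha> and \<open>lam\<close>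
  are nonnegative.\<close>

lemma weights_of_exponents:
  fixes g :: "real ^ 'p \<Rightarrow> real" and \<theta> :: "real ^ 'p"
  defines "\<beta> \<equiv> (lse (y ` I) g - lse (y ` I) (\<lambda>v. g v + \<theta> \<bullet> v), \<theta>)"
    and "q \<equiv> (\<lambda>v. exp (g v - lse (y ` I) g))"
  shows "weights \<beta> q"
    and "loglik \<beta> q = (\<Sum>k\<in>I. w k * (\<theta> \<bullet> y k) + g (y k)) - lam * (norm \<theta>)\<^sup>2
      - card I * ((1 - \<alpha>) * lse (y ` I) g + \<alpha> * lse (y ` I) (\<lambda>v. g v + \<theta> \<bullet> v))"
proof -
  have "(\<Sum>v\<in>y ` I. q v * tilt \<beta> v)
      = (\<Sum>v\<in>y ` I. exp ((g v + \<theta> \<bullet> v) - lse (y ` I) (\<lambda>v. g v + \<theta> \<bullet> v)))"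
    by (intro sum.cong refl) (simp add: q_def tilt_def \<beta>_def flip: exp_add)
  then show "weights \<beta> q"
    unfolding weights_def sum_exp_minus_lse[OF finite_P P_ne]
    using sum_exp_minus_lse[OF finite_P P_ne, of g] by (simp add: q_def)
  have "loglik \<beta> q = (\<Sum>k\<in>I. w k * (\<theta> \<bullet> y k) + g (y k)) + sum w I * fst \<beta>
      - card I * lse (y ` I) g - lam * (norm \<theta>)\<^sup>2"
    by (simp add: loglik_def q_def \<beta>_def sum.distrib sum_subtractf distrib_left
        sum_distrib_right)
  then show "loglik \<beta> q = (\<Sum>k\<in>I. w k * (\<theta> \<bullet> y k) + g (y k)) - lam * (norm \<theta>)\<^sup>2
      - card I * ((1 - \<alpha>) * lse (y ` I) g + \<alpha> * lse (y ` I) (\<lambda>v. g v + \<theta> \<bullet> v))"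
    by (simp add: sum_w \<beta>_def algebra_simps)
qed

lemma loglik_eq:
  "loglik \<beta> q = (\<Sum>k\<in>I. w k * (snd \<beta> \<bullet> y k) + ln (q (y k))) - lam * (norm (snd \<beta>))\<^sup>2
      + card I * (\<alpha> * fst \<beta>)"
  using sum_w by (simp add: loglik_def sum.distrib distrib_left flip: sum_distrib_right)

text \<open>Interpolate \<open>snd\<close> and \<open>ln q\<close> linearly, that is, mix the
  weights geometrically, and renormalize. Convexity of \<open>lse\<close> gives the likelihood
  bound; its Lipschitz continuity bounds the move of the intercept.\<close>

lemma log_mixture:
  assumes q0: "weights \<beta>0 q0" and q1: "weights \<beta>1 q1" and s: "0 \<le> s" "s \<le> 1"
    and D: "\<And>v. v \<in> y ` I \<Longrightarrow> \<bar>ln (q1 v) - ln (q0 v)\<bar> \<le> D"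
    and E: "\<And>v. v \<in> y ` I \<Longrightarrow> \<bar>(snd \<beta>1 - snd \<beta>0) \<bullet> v\<bar> \<le> E"
  shows "\<exists>\<beta> q. weights \<beta> q \<and> dist \<beta> \<beta>0 \<le> s * (2 * D + E + norm (snd \<beta>1 - snd \<beta>0)) \<and>
    (1 - s) * loglik \<beta>0 q0 + s * loglik \<beta>1 q1 \<le> loglik \<beta> q"
proof -
  define g where "g v = (1 - s) * ln (q0 v) + s * ln (q1 v)" for v
  define \<theta> where "\<theta> = (1 - s) *\<^sub>R snd \<beta>0 + s *\<^sub>R snd \<beta>1"
  define \<beta> where "\<beta> = (lse (y ` I) g - lse (y ` I) (\<lambda>v. g v + \<theta> \<bullet> v), \<theta>)"
  define q where "q v = exp (g v - lse (y ` I) g)" for v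
  note lse0 = weights_lse[OF q0] and lse1 = weights_lse[OF q1]
  note P = finite_P P_ne
  note wq = weights_of_exponents[of g \<theta>, folded \<beta>_def q_def[abs_def]]
  \<comment> \<open>The tilted exponents are jointly affine in \<open>(g, \<theta>)\<close>, so they
    interpolate linearly as well.\<close>
  have g\<theta>: "g v + \<theta> \<bullet> v = (1 - s) * (ln (q0 v) + snd \<beta>0 \<bullet> v) + s * (ln (q1 v) + snd \<beta>1 \<bullet> v)" for v
    by (simp add: g_def \<theta>_def inner_add_left algebra_simps)
  have conv1: "lse (y ` I) g \<le> 0"
    using lse_convex[OF P s, of "\<lambda>v. ln (q0 v)" "\<lambda>v. ln (q1 v)"] lse0 lse1
    by (simp add: g_def[abs_def])
  have conv2: "lse (y ` I) (\<lambda>v. g v + \<theta> \<bullet> v) \<le> (1 - s) * - fst \<beta>0 + s * - fst \<beta>1"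
    using lse_convex[OF P s, of "\<lambda>v. ln (q0 v) + snd \<beta>0 \<bullet> v" "\<lambda>v. ln (q1 v) + snd \<beta>1 \<bullet> v"]
    by (simp only: g\<theta> lse0 lse1)
  have dg: "\<bar>g v - ln (q0 v)\<bar> \<le> s * D" if "v \<in> y ` I" for v
  proof -
    have "g v - ln (q0 v) = s * (ln (q1 v) - ln (q0 v))" by (simp add: g_def algebra_simps)
    then show ?thesis using D[OF that] s by (simp add: abs_mult mult_left_mono)
  qed
  have dg\<theta>: "\<bar>(g v + \<theta> \<bullet> v) - (ln (q0 v) + snd \<beta>0 \<bullet> v)\<bar> \<le> s * (D + E)" if "v \<in> y ` I" for v
  proof -
    have "(g v + \<theta> \<bullet> v) - (ln (q0 v) + snd \<beta>0 \<bullet> v)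
        = s * ((ln (q1 v) - ln (q0 v)) + (snd \<beta>1 - snd \<beta>0) \<bullet> v)"
      unfolding g\<theta> by (simp add: inner_diff_left algebra_simps)
    moreover have "\<bar>(ln (q1 v) - ln (q0 v)) + (snd \<beta>1 - snd \<beta>0) \<bullet> v\<bar> \<le> D + E"
      using D[OF that] E[OF that] by linarith
    ultimately show ?thesis using s by (simp add: abs_mult mult_left_mono)
  qed
  have "\<bar>lse (y ` I) g - 0\<bar> \<le> s * D"
    using lse_lipschitz[OF P, of g "\<lambda>v. ln (q0 v)"] dg lse0 by simp
  moreover have "\<bar>lse (y ` I) (\<lambda>v. g v + \<theta> \<bullet> v) - - fst \<beta>0\<bar> \<le> s * (D + E)"
    using lse_lipschitz[OF P, of "\<lambda>v. g v + \<theta> \<bullet> v" "\<lambda>v. ln (q0 v) + snd \<beta>0 \<bullet> v"] dg\<theta> lse0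
    by simp
  \<comment> \<open>The intercept is a difference of two normalizers, which move by at most
    \<open>s * D\<close> and \<open>s * (D + E)\<close>.\<close>
  ultimately have fst: "\<bar>fst \<beta> - fst \<beta>0\<bar> \<le> s * (2 * D + E)"
    by (simp add: \<beta>_def algebra_simps abs_le_iff)
  have snd: "snd \<beta> - snd \<beta>0 = s *\<^sub>R (snd \<beta>1 - snd \<beta>0)"
    by (simp add: \<beta>_def \<theta>_def algebra_simps)
  have "dist \<beta> \<beta>0 \<le> \<bar>fst \<beta> - fst \<beta>0\<bar> + norm (snd \<beta> - snd \<beta>0)"
    using norm_Pair_le[of "fst \<beta> - fst \<beta>0" "snd \<beta> - snd \<beta>0"]
    by (simp add: dist_norm minus_prod_def)
  also have "\<dots> \<le> s * (2 * D + E + norm (snd \<beta>1 - snd \<beta>0))"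
    using fst s by (simp add: snd distrib_left)
  finally have dist: "dist \<beta> \<beta>0 \<le> s * (2 * D + E + norm (snd \<beta>1 - snd \<beta>0))" .
  have lin: "(\<Sum>k\<in>I. w k * (\<theta> \<bullet> y k) + g (y k))
      = (1 - s) * (\<Sum>k\<in>I. w k * (snd \<beta>0 \<bullet> y k) + ln (q0 (y k)))
        + s * (\<Sum>k\<in>I. w k * (snd \<beta>1 \<bullet> y k) + ln (q1 (y k)))"
    by (simp add: g_def \<theta>_def inner_add_left sum_distrib_left sum.distrib[symmetric] algebra_simps)
  have nrm: "lam * (norm \<theta>)\<^sup>2 \<le> lam * ((1 - s) * (norm (snd \<beta>0))\<^sup>2 + s * (norm (snd \<beta>1))\<^sup>2)"
    unfolding \<theta>_def by (intro mult_left_mono norm_power2_convex s lam_nonneg)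
  have "(1 - \<alpha>) * lse (y ` I) g \<le> (1 - \<alpha>) * 0"
    using conv1 \<alpha>_less_1 by (intro mult_left_mono) auto
  moreover have "\<alpha> * lse (y ` I) (\<lambda>v. g v + \<theta> \<bullet> v) \<le> \<alpha> * ((1 - s) * - fst \<beta>0 + s * - fst \<beta>1)"
    using conv2 \<alpha>_pos by (intro mult_left_mono) auto
  ultimately have "card I * ((1 - \<alpha>) * lse (y ` I) g + \<alpha> * lse (y ` I) (\<lambda>v. g v + \<theta> \<bullet> v))
      \<le> card I * (\<alpha> * ((1 - s) * - fst \<beta>0 + s * - fst \<beta>1))"
    by (intro mult_left_mono) auto
  with nrm have "(1 - s) * loglik \<beta>0 q0 + s * loglik \<beta>1 q1 \<le> loglik \<beta> q"
    unfolding wq(2) lin loglik_eq[of \<beta>0 q0] loglik_eq[of \<beta>1 q1]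
    by (simp add: algebra_simps)
  with wq(1) dist show ?thesis by blast
qed

text \<open>Weights are at most 1, so all terms \<open>ln (q (y i))\<close> are nonpositive and a
  lower bound on their sum bounds each of them. The resulting bound depends on
  \<open>\<beta>\<close> and \<open>r\<close>, but not on \<open>q\<close>.\<close>

lemma loglik_bounds_weights:
  "\<exists>B. \<forall>q v. weights \<beta> q \<and> r \<le> loglik \<beta> q \<and> v \<in> y ` I \<longrightarrow> \<bar>ln (q v)\<bar> \<le> B"
proof (intro exI allI impI)
  fix q v assume q: "weights \<beta> q \<and> r \<le> loglik \<beta> q \<and> v \<in> y ` I"
  then obtain k where k: "k \<in> I" "v = y k" by blast
  have q_nonneg: "\<And>u. u \<in> y ` I \<Longrightarrow> 0 \<le> q u" using q by (auto simp: weights_def less_imp_le)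
  have "q u \<le> 1" if "u \<in> y ` I" for u
    using member_le_sum[of u "y ` I" q] q_nonneg that finite_P q by (simp add: weights_def)
  then have neg: "ln (q (y i)) \<le> 0" if "i \<in> I" for i
    using q that by (simp add: weights_def)
  have "(\<Sum>i\<in>I - {k}. ln (q (y i))) \<le> 0"
    by (intro sum_nonpos neg) simp
  then have "(\<Sum>i\<in>I. ln (q (y i))) \<le> ln (q (y k))"
    by (simp add: sum.remove[OF finite_I k(1)])
  then have "\<bar>ln (q v)\<bar> \<le> (\<Sum>i\<in>I. w i * (fst \<beta> + snd \<beta> \<bullet> y i)) - lam * (norm (snd \<beta>))\<^sup>2 - r"
    using neg[OF k(1)] q k by (simp add: loglik_def sum.distrib)
  then show "\<bar>ln (q v)\<bar> \<le> (\<Sum>i\<in>I. w i * (fst \<beta> + snd \<beta> \<bullet> y i)) - lam * (norm (snd \<beta>))\<^sup>2 - r" .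
qed

text \<open>Along segments in \<open>(snd \<beta>, ln q)\<close>, the component \<open>fst \<beta>\<close> moves Lipschitz-continuously;
  the constant is uniform over near-optimal weights, so the supremum in \<open>pQ\<close> need not be known
  to be attained.\<close>

lemma improve_nearby:
  assumes q1: "weights \<beta>1 q1" and r: "r < loglik \<beta>1 q1" and e: "0 < e"
  shows "\<exists>\<delta>>0. \<forall>q0. weights \<beta>0 q0 \<and> r - \<delta> < loglik \<beta>0 q0 \<longrightarrow>
    (\<exists>\<beta> q. weights \<beta> q \<and> dist \<beta> \<beta>0 < e \<and> r < loglik \<beta> q)"
proof -
  obtain B0 where B0: "\<And>q v. weights \<beta>0 q \<Longrightarrow> r - 1 \<le> loglik \<beta>0 q \<Longrightarrow> v \<in> y ` I \<Longrightarrow> \<bar>ln (q v)\<bar> \<le> B0"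
    using loglik_bounds_weights[of \<beta>0 "r - 1"] by blast
  obtain B1 where B1: "\<And>v. v \<in> y ` I \<Longrightarrow> \<bar>ln (q1 v)\<bar> \<le> B1"
    using loglik_bounds_weights[of \<beta>1 r] q1 r by force
  define E where "E = Max ((\<lambda>v. \<bar>(snd \<beta>1 - snd \<beta>0) \<bullet> v\<bar>) ` y ` I)"
  have E: "\<bar>(snd \<beta>1 - snd \<beta>0) \<bullet> v\<bar> \<le> E" if "v \<in> y ` I" for v
    unfolding E_def using finite_P that by (intro Max_ge) auto
  define M where "M = 2 * (B0 + B1) + E + norm (snd \<beta>1 - snd \<beta>0)"
  \<comment> \<open>Small enough that the displacement \<open>s * M\<close> stays below
    \<open>e\<close>; the cap \<open>1 / 2\<close> keeps \<open>s\<close> below 1.\<close>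
  define s where "s = min (1 / 2) (e / (2 * (\<bar>M\<bar> + 1)))"
  have s: "0 < s" "s < 1" using e by (auto simp: s_def)
  have "s * M \<le> s * (\<bar>M\<bar> + 1)" using s by (intro mult_left_mono) auto
  also have "\<dots> \<le> e / (2 * (\<bar>M\<bar> + 1)) * (\<bar>M\<bar> + 1)"
    by (intro mult_right_mono) (auto simp: s_def)
  also have "\<dots> = e / 2" by (simp add: field_simps)
  finally have sM: "s * M < e" using e by simp
  \<comment> \<open>The cap 1 puts \<open>q0\<close> within reach of \<open>B0\<close>; the other
    bound lets the gain \<open>s * (loglik \<beta>1 q1 - r)\<close> outweigh the loss
    \<open>(1 - s) * \<delta>\<close>.\<close>
  define \<delta> where "\<delta> = min 1 (s * (loglik \<beta>1 q1 - r))"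
  have \<delta>: "0 < \<delta>" using s r by (simp add: \<delta>_def)
  have "\<exists>\<beta> q. weights \<beta> q \<and> dist \<beta> \<beta>0 < e \<and> r < loglik \<beta> q"
    if q0: "weights \<beta>0 q0" and near: "r - \<delta> < loglik \<beta>0 q0" for q0
  proof -
    have "\<bar>ln (q1 v) - ln (q0 v)\<bar> \<le> B0 + B1" if "v \<in> y ` I" for v
      using B0[OF q0 _ that] B1[OF that] near by (force simp: \<delta>_def)
    from log_mixture[OF q0 q1 _ _ this E, of s] s obtain \<beta> q where
      \<beta>: "weights \<beta> q" "dist \<beta> \<beta>0 \<le> s * M"
        "(1 - s) * loglik \<beta>0 q0 + s * loglik \<beta>1 q1 \<le> loglik \<beta> q"
      by (auto simp: M_def)
    have "(1 - s) * (r - \<delta>) < (1 - s) * loglik \<beta>0 q0"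
      using near s by (intro mult_strict_left_mono) auto
    moreover have "\<delta> * (1 - s) \<le> s * (loglik \<beta>1 q1 - r)"
      using mult_left_le[of "1 - s" \<delta>] s \<delta> by (simp add: \<delta>_def)
    ultimately have "r < loglik \<beta> q" using \<beta>(3) by (simp add: algebra_simps)
    moreover have "dist \<beta> \<beta>0 < e" using \<beta>(2) sM by linarith
    ultimately show ?thesis using \<beta>(1) by blast
  qed
  with \<delta> show ?thesis by blast
qed

text \<open>A feasible distribution may vanish at data points, where \<open>Q\<close> is -
  \<infinity>. Mixing in a little of \<open>freq\<close> makes it positive, and a small intercept
  shift restores the tilted constraint.\<close>

lemma positive_weights_nearby:
  assumes q: "\<And>v. v \<in> y ` I \<Longrightarrow> 0 \<le> q v" "(\<Sum>v\<in>y ` I. q v) = 1" "(\<Sum>v\<in>y ` I. q v * tilt \<beta> v) = 1"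
    and e: "0 < e"
  shows "\<exists>\<beta>' q'. weights \<beta>' q' \<and> dist \<beta>' \<beta> < e"
proof -
  define c where "c = (\<Sum>v\<in>y ` I. freq v * tilt \<beta> v)"
  have c: "0 < c" unfolding c_def by (intro sum_pos mult_pos_pos finite_P P_ne freq_pos tilt_pos)
  have "((\<lambda>s. ln (1 - s + s * c)) \<longlongrightarrow> ln (1 - 0 + 0 * c)) (at_right 0)"
    by (intro tendsto_intros) auto
  then have "((\<lambda>s. ln (1 - s + s * c)) \<longlongrightarrow> 0) (at_right 0)" by simp
  from tendstoD[OF this e] have "\<forall>\<^sub>F s in at_right 0. \<bar>ln (1 - s + s * c)\<bar> < e"
    by (simp add: dist_real_def)
  moreover have "\<forall>\<^sub>F s in at_right (0::real). s \<in> {0<..<1}"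
    by (rule eventually_at_right_real) simp
  ultimately have "\<forall>\<^sub>F s in at_right 0. \<bar>ln (1 - s + s * c)\<bar> < e \<and> s \<in> {0<..<1}"
    by (rule eventually_conj)
  then obtain s where s: "\<bar>ln (1 - s + s * c)\<bar> < e" "0 < s" "s < 1"
    using eventually_happens'[OF trivial_limit_at_right_real] by fastforce
  define q' where "q' v = (1 - s) * q v + s * freq v" for v
  \<comment> \<open>The mixture has tilted mass \<open>1 - s + s * c\<close>; the shift by its
    logarithm divides it out.\<close>
  define \<beta>' where "\<beta>' = (fst \<beta> - ln (1 - s + s * c), snd \<beta>)"
  have sc: "0 < 1 - s + s * c" using s c by (intro add_pos_pos) auto
  have t: "tilt \<beta>' v = tilt \<beta> v / (1 - s + s * c)" for v
    using sc by (simp add: tilt_def \<beta>'_def exp_add exp_diff)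
  have "(\<Sum>v\<in>y ` I. q' v) = (1 - s) * (\<Sum>v\<in>y ` I. q v) + s * (\<Sum>v\<in>y ` I. freq v)"
    by (simp add: q'_def sum.distrib sum_distrib_left)
  moreover have "(\<Sum>v\<in>y ` I. q' v * tilt \<beta> v) = (1 - s) * (\<Sum>v\<in>y ` I. q v * tilt \<beta> v) + s * c"
    by (simp add: q'_def c_def sum_distrib_left sum.distrib[symmetric] algebra_simps)
  then have "(\<Sum>v\<in>y ` I. q' v * tilt \<beta>' v) = 1"
    using sc q by (simp add: t flip: sum_divide_distrib)
  moreover have "0 < q' v" if "v \<in> y ` I" for v
    using q(1)[OF that] freq_pos[OF that] s by (auto simp: q'_def intro!: add_nonneg_pos)
  ultimately have "weights \<beta>' q'" using q sum_freq by (simp add: weights_def)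
  moreover have "dist \<beta>' \<beta> < e"
    using s by (cases \<beta>) (simp add: \<beta>'_def dist_Pair_Pair dist_real_def)
  ultimately show ?thesis by blast
qed

end

section \<open>Logarithms at zero and the binary cross entropy\<close>

text \<open>If \<open>a\<close> or \<open>b\<close> is zero, its coefficient is zero and the product
  vanishes. If \<open>g = 0\<close>, both logarithms are - \<infinity>, and at least one coefficient
  is positive.\<close>

lemma elog_term:
  assumes "0 \<le> w" "w \<le> 1" "0 \<le> a" "0 \<le> b" "a = 0 \<Longrightarrow> w = 1" "b = 0 \<Longrightarrow> w = 0" "0 < t" "0 \<le> g"
  shows "ereal (1 - w) * elog (a * g) + ereal w * elog (b * t * g) =
    (if g = 0 then - \<infinity> else ereal ((1 - w) * ln a + w * ln b + w * ln t + ln g))"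
proof (cases "g = 0")
  case True
  then show ?thesis using assms by (cases "w = 0"; cases "w = 1") (auto simp: elog_def)
next
  case False
  then have g: "0 < g" using assms by simp
  have "ereal (1 - w) * elog (a * g) = ereal ((1 - w) * (ln a + ln g))"
  proof (cases "a = 0")
    case False
    then have "0 < a" using assms by simp
    then show ?thesis using g by (simp add: elog_def ln_mult_pos not_le)
  qed (use assms in \<open>simp add: zero_ereal_def[symmetric]\<close>)
  moreover have "ereal w * elog (b * t * g) = ereal (w * (ln b + ln t + ln g))"
  proof (cases "b = 0")
    case False
    then have "0 < b" using assms by simp
    then show ?thesis using g \<open>0 < t\<close> by (simp add: elog_def ln_mult_pos not_le)
  qed (use assms in \<open>simp add: zero_ereal_def[symmetric]\<close>)
  ultimately show ?thesis using False by (simp add: algebra_simps)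
qed

lemma ln_quotient_term:
  fixes w a b t d :: real
  assumes "0 \<le> a" "0 \<le> b" "a = 0 \<Longrightarrow> w = 1" "b = 0 \<Longrightarrow> w = 0" "0 < t" "0 < d"
  shows "(1 - w) * ln (a / d) + w * ln (b * t / d) =
    ((1 - w) * ln a + w * ln b) + (w * ln t - ln d)"
proof -
  have "(1 - w) * ln (a / d) = (1 - w) * (ln a - ln d)"
    using assms by (cases "a = 0") (auto simp: ln_divide_pos)
  moreover have "w * ln (b * t / d) = w * (ln b + ln t - ln d)"
    using assms by (cases "b = 0") (auto simp: ln_divide_pos ln_mult_pos)
  ultimately show ?thesis by (simp add: algebra_simps)
qed

text \<open>In \<open>ereal\<close>, \<infinity> absorbs - \<infinity>, hence the last
  hypothesis.\<close>

lemma sum_ereal_MInfty: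
  fixes f :: "'a \<Rightarrow> ereal"
  assumes "finite A" "a \<in> A" "f a = - \<infinity>" "\<And>b. b \<in> A \<Longrightarrow> f b \<noteq> \<infinity>"
  shows "sum f A = - \<infinity>"
proof -
  have "sum f (A - {a}) \<noteq> \<infinity>" using assms by (auto simp: sum_Pinfty)
  then show ?thesis using assms by (simp add: sum.remove[of A a])
qed

text \<open>Gibbs' inequality for two outcomes: the bounds \<open>r - p\<close> and
  \<open>(1 - r) - (1 - p)\<close> cancel.\<close>

lemma binary_cross_entropy_le:
  fixes p r :: real
  assumes "0 < p" "p < 1" "0 < r" "r < 1"
  shows "(1 - p) * ln (1 - r) + p * ln r \<le> (1 - p) * ln (1 - p) + p * ln p"
proof -
  have le: "a * (ln b - ln a) \<le> b - a" if "0 < a" "0 < b" for a b :: real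
  proof -
    have "a * ln (b / a) \<le> a * (b / a - 1)"
      using that by (intro mult_left_mono ln_le_minus_one) auto
    then show ?thesis using that by (simp add: ln_divide_pos right_diff_distrib)
  qed
  show ?thesis
    using le[of "1 - p" "1 - r"] le[of p r] assms by (simp add: algebra_simps)
qed

section \<open>The EM step: separating \<open>\<rho>\<close> from \<open>\<beta>\<close> and the
  distribution\<close>

locale em_step =
  fixes n :: "nat \<Rightarrow> nat" and x :: "nat \<Rightarrow> nat \<Rightarrow> real ^ 'p"
    and lam gam rho0 \<rho>t :: real and \<beta>t :: "real \<times> (real ^ 'p)"
  assumes n_pos: "\<And>j. j \<in> {1..3} \<Longrightarrow> n j \<ge> 1"
    and lam: "lam \<ge> 0" and gam: "gam \<ge> 0"
    and rho0: "rho0 \<in> {0<..<1}" and \<rho>t: "\<rho>t \<in> {0<..<1}"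
begin

definition idx :: "(nat \<times> nat) set" where
  "idx = (SIGMA j:{1..3}. {1..n j})"

definition resp :: "nat \<times> nat \<Rightarrow> real" where
  "resp k = Eu \<rho>t \<beta>t x (fst k) (snd k)"

definition obs :: "nat \<times> nat \<Rightarrow> real ^ 'p" where
  "obs k = x (fst k) (snd k)"

text \<open>Carries all the dependence of \<open>Q\<close> and \<open>kappaQ\<close> on
  \<open>\<rho>\<close>, for \<open>\<rho>\<close> in (0,1).\<close>

definition part :: "real \<Rightarrow> real" where
  "part \<rho> = (1 / real (total n)) *
      (\<Sum>k\<in>idx. (1 - resp k) * ln (1 - mix \<rho> (fst k)) + resp k * ln (mix \<rho> (fst k)))
    + gam * (1 - rho0) * (real (n 3) / real (total n)) * ln (1 - \<rho>)
    + gam * rho0 * (real (n 3) / real (total n)) * ln \<rho>"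

abbreviation \<rho>n :: real where "\<rho>n \<equiv> rho_next n x gam rho0 \<rho>t \<beta>t"
abbreviation \<alpha>n :: real where "\<alpha>n \<equiv> alpha_next n x \<rho>t \<beta>t"

lemma sum_idx: "(\<Sum>j\<in>{1..3}. \<Sum>i\<in>{1..n j}. f j i) = (\<Sum>k\<in>idx. f (fst k) (snd k))"
  for f :: "nat \<Rightarrow> nat \<Rightarrow> 'b::comm_monoid_add"
  unfolding idx_def by (simp add: sum.Sigma case_prod_unfold)

lemma atLeastAtMost_1_3: "{1..3} = {1, 2, 3::nat}"
  by auto

lemma sum_idx_123: "(\<Sum>k\<in>idx. f (fst k) (snd k))
    = (\<Sum>i\<in>{1..n 1}. f 1 i) + (\<Sum>i\<in>{1..n 2}. f 2 i) + (\<Sum>i\<in>{1..n 3}. f 3 i)"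
  for f :: "nat \<Rightarrow> nat \<Rightarrow> real"
  unfolding sum_idx[symmetric] atLeastAtMost_1_3 by simp

lemma finite_idx: "finite idx"
  by (simp add: idx_def)

lemma card_idx: "card idx = total n"
  by (simp add: idx_def total_def)

lemma n_pos_123: "0 < n 1" "0 < n 2" "0 < n 3"
  using n_pos[of 1] n_pos[of 2] n_pos[of 3] by auto

lemma total_pos: "0 < real (total n)"
  unfolding total_def atLeastAtMost_1_3 using n_pos_123 by simp

lemma Eu_1: "Eu \<rho>t \<beta>t x 1 i = 0" and Eu_2: "Eu \<rho>t \<beta>t x 2 i = 1"
  by (simp_all add: Eu_def mix_def tilt_def)

lemma Eu_3: "0 < Eu \<rho>t \<beta>t x 3 i" "Eu \<rho>t \<beta>t x 3 i < 1"
proof -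
  have "0 < \<rho>t * tilt \<beta>t (x 3 i)" using \<rho>t by (simp add: tilt_def)
  then show "0 < Eu \<rho>t \<beta>t x 3 i" "Eu \<rho>t \<beta>t x 3 i < 1"
    using \<rho>t by (auto simp: Eu_def mix_def intro!: divide_pos_pos add_pos_pos)
qed

lemma sum_Eu_3: "0 < (\<Sum>i\<in>{1..n 3}. Eu \<rho>t \<beta>t x 3 i)" "(\<Sum>i\<in>{1..n 3}. Eu \<rho>t \<beta>t x 3 i) < n 3"
proof -
  show "0 < (\<Sum>i\<in>{1..n 3}. Eu \<rho>t \<beta>t x 3 i)"
    using Eu_3 n_pos_123 by (intro sum_pos) auto
  have "(\<Sum>i\<in>{1..n 3}. Eu \<rho>t \<beta>t x 3 i) < (\<Sum>i\<in>{1..n 3}. 1)"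
    using Eu_3 n_pos_123 by (intro sum_strict_mono) auto
  then show "(\<Sum>i\<in>{1..n 3}. Eu \<rho>t \<beta>t x 3 i) < n 3" by simp
qed

lemma alpha_next_eq: "\<alpha>n * total n = sum resp idx"
  using total_pos unfolding alpha_next_def resp_def sum_idx by simp

text \<open>Sample 1 contributes nothing to the sum, sample 2 its full size, and sample 3 a value
  strictly between 0 and its size.\<close>

lemma alpha_next_bounds: "0 < \<alpha>n" "\<alpha>n < 1"
proof -
  have "\<alpha>n * total n = n 2 + (\<Sum>i\<in>{1..n 3}. Eu \<rho>t \<beta>t x 3 i)"
    unfolding alpha_next_eq resp_def sum_idx_123 Eu_1 Eu_2 by simp
  moreover have "real (total n) = n 1 + n 2 + n 3"
    unfolding total_def atLeastAtMost_1_3 by simp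
  ultimately have "0 < \<alpha>n * total n" "\<alpha>n * total n < 1 * total n"
    using sum_Eu_3 n_pos_123 by auto
  then show "0 < \<alpha>n" "\<alpha>n < 1"
    using total_pos by (simp_all add: zero_less_mult_iff)
qed

text \<open>A weighted mean, with weights 1 and \<open>gam\<close>, of two numbers in (0,1).\<close>

lemma rho_next_bounds: "0 < \<rho>n" "\<rho>n < 1"
proof -
  let ?m = "(1 / real (n 3)) * (\<Sum>i\<in>{1..n 3}. Eu \<rho>t \<beta>t x 3 i)"
  have m: "0 < ?m" "?m < 1" using sum_Eu_3 n_pos_123 by auto
  have g: "0 \<le> gam * rho0" "gam * rho0 \<le> gam"
    using gam rho0 by (auto intro: mult_left_le)
  show "0 < \<rho>n" using m g gam unfolding rho_next_def by (intro divide_pos_pos) auto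
  show "\<rho>n < 1" using m g gam unfolding rho_next_def by (subst divide_less_eq_1_pos) auto
qed

text \<open>The penalty is scaled by \<open>total n\<close> because \<open>loglik\<close> and
  \<open>dual\<close> are not divided by the sample size.\<close>

sublocale tilted_sample idx resp obs \<alpha>n "total n * lam"
proof
  show "idx \<noteq> {}" using card_idx total_pos by auto
qed (use finite_idx alpha_next_bounds lam in \<open>auto simp: alpha_next_eq card_idx\<close>)

lemma pooled_eq: "pooled n x = obs ` idx"
  by (force simp: pooled_def idx_def obs_def)

text \<open>The last two facts justify \<open>0 log 0 = 0\<close>: a degenerate mixing proportion
  comes with the same degenerate responsibility.\<close>

lemma resp_mix:
  assumes "k \<in> idx" "0 < \<rho>" "\<rho> < 1"
  shows "0 \<le> resp k" "resp k \<le> 1" "0 \<le> mix \<rho> (fst k)" "mix \<rho> (fst k) \<le> 1"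
    "mix \<rho> (fst k) = 1 \<Longrightarrow> resp k = 1" "mix \<rho> (fst k) = 0 \<Longrightarrow> resp k = 0"
proof -
  have "fst k = 1 \<or> fst k = 2 \<or> fst k = 3" using assms(1) by (auto simp: idx_def)
  then show "0 \<le> resp k" "resp k \<le> 1" "0 \<le> mix \<rho> (fst k)" "mix \<rho> (fst k) \<le> 1"
    "mix \<rho> (fst k) = 1 \<Longrightarrow> resp k = 1" "mix \<rho> (fst k) = 0 \<Longrightarrow> resp k = 0"
    using assms Eu_1 Eu_2 Eu_3 by (auto simp: resp_def mix_def less_imp_le)
qed

lemma ln_tilt: "ln (tilt \<beta> v) = fst \<beta> + snd \<beta> \<bullet> v"
  by (simp add: tilt_def)

lemma kappaQ_eq:
  assumes "0 < \<rho>" "\<rho> < 1"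
  shows "kappaQ n x lam gam rho0 \<rho>t \<beta>t \<rho> \<beta> \<alpha>n = part \<rho> + dual \<beta> / total n - ln (total n)"
proof -
  have "(\<Sum>j\<in>{1..3}. \<Sum>i\<in>{1..n j}.
          (1 - Eu \<rho>t \<beta>t x j i) * ln ((1 - mix \<rho> j) / (1 - \<alpha>n + \<alpha>n * tilt \<beta> (x j i)))
        + Eu \<rho>t \<beta>t x j i * ln (mix \<rho> j * tilt \<beta> (x j i) / (1 - \<alpha>n + \<alpha>n * tilt \<beta> (x j i))))
     = (\<Sum>k\<in>idx. (1 - resp k) * ln ((1 - mix \<rho> (fst k)) / den \<beta> (obs k))
        + resp k * ln (mix \<rho> (fst k) * tilt \<beta> (obs k) / den \<beta> (obs k)))"
    unfolding sum_idx resp_def obs_def den_def ..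
  also have "\<dots> = (\<Sum>k\<in>idx. ((1 - resp k) * ln (1 - mix \<rho> (fst k)) + resp k * ln (mix \<rho> (fst k)))
        + (resp k * (fst \<beta> + snd \<beta> \<bullet> obs k) - ln (den \<beta> (obs k))))"
    unfolding ln_tilt[symmetric]
    using resp_mix[OF _ assms] by (intro sum.cong refl ln_quotient_term tilt_pos den_pos) auto
  finally show ?thesis
    using total_pos
    by (simp add: kappaQ_def part_def pen_def dual_def sum.distrib distrib_left diff_divide_distrib
        add_divide_distrib)
qed

text \<open>The two coefficients of each observation sum to one, so \<open>ln (pmf G v)\<close>
  enters once per observation, and a data point of mass zero forces - \<infinity>.\<close>

lemma Q_eq:
  assumes "0 < \<rho>" "\<rho> < 1"
  shows "Q n x lam gam rho0 \<rho>t \<beta>t \<rho> \<beta> G = (if \<exists>v\<in>obs ` idx. pmf G v = 0 then - \<infinity>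
    else ereal (part \<rho> + loglik \<beta> (pmf G) / total n))"
proof -
  let ?h = "\<lambda>k. (1 - resp k) * ln (1 - mix \<rho> (fst k)) + resp k * ln (mix \<rho> (fst k))
      + resp k * (fst \<beta> + snd \<beta> \<bullet> obs k) + ln (pmf G (obs k))"
  let ?t = "\<lambda>k. if pmf G (obs k) = 0 then - \<infinity> else ereal (?h k)"
  have Q: "Q n x lam gam rho0 \<rho>t \<beta>t \<rho> \<beta> G
      = ereal (1 / total n) * (\<Sum>k\<in>idx. ?t k) + ereal (pen n lam gam rho0 \<rho> \<beta>)"
  proof -
    have "(\<Sum>j\<in>{1..3}. \<Sum>i\<in>{1..n j}.
          ereal (1 - Eu \<rho>t \<beta>t x j i) * elog ((1 - mix \<rho> j) * pmf G (x j i))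
        + ereal (Eu \<rho>t \<beta>t x j i) * elog (mix \<rho> j * tilt \<beta> (x j i) * pmf G (x j i)))
      = (\<Sum>k\<in>idx. ereal (1 - resp k) * elog ((1 - mix \<rho> (fst k)) * pmf G (obs k))
        + ereal (resp k) * elog (mix \<rho> (fst k) * tilt \<beta> (obs k) * pmf G (obs k)))"
      unfolding sum_idx resp_def obs_def ..
    also have "\<dots> = (\<Sum>k\<in>idx. ?t k)"
      unfolding ln_tilt[symmetric]
      using resp_mix[OF _ assms] by (intro sum.cong refl elog_term tilt_pos pmf_nonneg) auto
    finally show ?thesis unfolding Q_def by (rule arg_cong)
  qed
  show ?thesis
  proof (cases "\<exists>v\<in>obs ` idx. pmf G v = 0")
    case True
    then obtain k where "k \<in> idx" "pmf G (obs k) = 0" by auto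
    then have "(\<Sum>k\<in>idx. ?t k) = - \<infinity>" by (intro sum_ereal_MInfty[of _ k] finite_idx) auto
    then show ?thesis using True total_pos by (simp add: Q)
  next
    case False
    then have "(\<Sum>k\<in>idx. ?t k) = (\<Sum>k\<in>idx. ereal (?h k))" by (intro sum.cong) auto
    also have "\<dots> = ereal (\<Sum>k\<in>idx. ?h k)" by simp
    finally have "Q n x lam gam rho0 \<rho>t \<beta>t \<rho> \<beta> G
        = ereal ((\<Sum>k\<in>idx. ?h k) / total n + pen n lam gam rho0 \<rho> \<beta>)"
      by (simp add: Q)
    also have "(\<Sum>k\<in>idx. ?h k) / total n + pen n lam gam rho0 \<rho> \<beta>
        = part \<rho> + loglik \<beta> (pmf G) / total n"
      using total_pos
      by (simp add: part_def pen_def loglik_def sum.distrib distrib_left diff_divide_distrib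
          add_divide_distrib)
    finally show ?thesis using False by simp
  qed
qed

text \<open>Samples 1 and 2 contribute \<open>ln 1 = 0\<close>. The penalty acts like
  \<open>gam * n 3\<close> further observations with success probability \<open>rho0\<close>, so
  \<open>part\<close> is a nonnegative multiple of the negative cross entropy relative to
  \<open>\<rho>n\<close>.\<close>

lemma part_le_rho_next:
  assumes "0 < \<rho>" "\<rho> < 1"
  shows "part \<rho> \<le> part \<rho>n"
proof -
  let ?c = "real (n 3) / total n * (1 + gam)" and ?e = "\<Sum>i\<in>{1..n 3}. Eu \<rho>t \<beta>t x 3 i"
  have part: "part r = ?c * ((1 - \<rho>n) * ln (1 - r) + \<rho>n * ln r)" for r
  proof -
    have 1: "\<rho>n * (1 + gam) * n 3 = ?e + gam * rho0 * n 3"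
    proof -
      have "\<rho>n * (1 + gam) = (1 / real (n 3)) * ?e + gam * rho0"
        using gam by (simp add: rho_next_def)
      then show ?thesis using n_pos_123 by (simp add: distrib_right)
    qed
    have "(\<Sum>k\<in>idx. (1 - resp k) * ln (1 - mix r (fst k)) + resp k * ln (mix r (fst k)))
        = (\<Sum>i\<in>{1..n 3}. (1 - Eu \<rho>t \<beta>t x 3 i) * ln (1 - r) + Eu \<rho>t \<beta>t x 3 i * ln r)"
      unfolding resp_def sum_idx_123[of "\<lambda>j i. (1 - Eu \<rho>t \<beta>t x j i) * ln (1 - mix r j) + Eu \<rho>t \<beta>t x j i * ln (mix r j)"]
        Eu_1 Eu_2 by (simp add: mix_def)
    also have "\<dots> = (n 3 - ?e) * ln (1 - r) + ?e * ln r"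
      by (simp add: sum.distrib sum_subtractf flip: sum_distrib_right)
    finally have "part r = 1 / total n * ((n 3 - ?e) * ln (1 - r) + ?e * ln r)
        + gam * (1 - rho0) * (n 3 / total n) * ln (1 - r) + gam * rho0 * (n 3 / total n) * ln r"
      unfolding part_def by simp
    then have "part r * total n = (n 3 - ?e) * ln (1 - r) + ?e * ln r
        + gam * (1 - rho0) * n 3 * ln (1 - r) + gam * rho0 * n 3 * ln r"
      using total_pos by (simp add: distrib_right add_divide_distrib)
    also have "\<dots> = (n 3 * (1 + gam) - (?e + gam * rho0 * n 3)) * ln (1 - r)
        + (?e + gam * rho0 * n 3) * ln r"
      by (simp add: algebra_simps)
    also have "\<dots> = n 3 * (1 + gam) * ((1 - \<rho>n) * ln (1 - r) + \<rho>n * ln r)"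
      unfolding 1[symmetric] by (simp add: algebra_simps)
    finally show ?thesis using total_pos by (simp add: field_simps)
  qed
  show ?thesis
    unfolding part using binary_cross_entropy_le[OF rho_next_bounds assms] gam
    by (intro mult_left_mono) auto
qed

section \<open>Profiling over the distribution\<close>

lemma feasible_iff:
  "G \<in> feasible n x \<beta> \<longleftrightarrow> set_pmf G \<subseteq> obs ` idx \<and> (\<Sum>v\<in>obs ` idx. pmf G v * tilt \<beta> v) = 1"
proof -
  have "measure_pmf.expectation G (tilt \<beta>) = (\<Sum>v\<in>obs ` idx. pmf G v * tilt \<beta> v)"
    if "set_pmf G \<subseteq> obs ` idx"
    using that finite_P by (subst integral_measure_pmf_real[of "obs ` idx"]) (auto simp: mult.commute)
  then show ?thesis by (auto simp: feasible_def pooled_eq)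
qed

lemma feasible_weights:
  assumes "G \<in> feasible n x \<beta>" "\<not> (\<exists>v\<in>obs ` idx. pmf G v = 0)"
  shows "weights \<beta> (pmf G)"
  using assms finite_P by (auto simp: feasible_iff weights_def sum_pmf_eq_1 order_less_le)

lemma weights_feasible:
  assumes "weights \<beta> q"
  obtains G where "G \<in> feasible n x \<beta>" "\<And>v. v \<in> obs ` idx \<Longrightarrow> pmf G v = q v"
proof -
  let ?q = "\<lambda>v. if v \<in> obs ` idx then q v else 0"
  have nonneg: "0 \<le> ?q v" for v using assms by (auto simp: weights_def less_imp_le)
  have "(\<integral>\<^sup>+ v. ennreal (?q v) \<partial>count_space UNIV) = (\<Sum>v\<in>obs ` idx. ennreal (?q v))"
    using finite_P by (intro nn_integral_count_space'[of "obs ` idx"]) auto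
  also have "\<dots> = ennreal (\<Sum>v\<in>obs ` idx. ?q v)"
    by (intro sum_ennreal nonneg)
  also have "\<dots> = 1" using assms by (simp add: weights_def)
  finally have pmf: "pmf (embed_pmf ?q) v = ?q v" for v
    using nonneg by (intro pmf_embed_pmf) auto
  have "set_pmf (embed_pmf ?q) \<subseteq> obs ` idx"
    by (auto simp: set_pmf_iff pmf split: if_splits)
  moreover have "(\<Sum>v\<in>obs ` idx. pmf (embed_pmf ?q) v * tilt \<beta> v) = 1"
    using assms by (simp add: pmf weights_def)
  ultimately have "embed_pmf ?q \<in> feasible n x \<beta>" by (simp add: feasible_iff)
  then show thesis using that pmf by simp
qed

lemma loglik_cong: "(\<And>v. v \<in> obs ` idx \<Longrightarrow> q v = q' v) \<Longrightarrow> loglik \<beta> q = loglik \<beta> q'"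
  by (simp add: loglik_def)

abbreviation pq :: "real \<Rightarrow> real \<times> (real ^ 'p) \<Rightarrow> ereal" where
  "pq \<equiv> pQ n x lam gam rho0 \<rho>t \<beta>t"

lemma pQ_le:
  assumes "0 < \<rho>" "\<rho> < 1"
  shows "pq \<rho> \<beta> \<le> ereal (part \<rho> + (dual \<beta> + entropy) / total n)"
  unfolding pQ_def
proof (rule SUP_least)
  fix G assume G: "G \<in> feasible n x \<beta>"
  show "Q n x lam gam rho0 \<rho>t \<beta>t \<rho> \<beta> G \<le> ereal (part \<rho> + (dual \<beta> + entropy) / total n)"
    using loglik_le_dual[OF feasible_weights[OF G]] total_pos
    by (auto simp: Q_eq[OF assms] intro!: divide_right_mono)
qed

text \<open>Any positive weights give a competitor in the supremum; this also certifies membership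
  in the domain.\<close>

lemma pQ_ge:
  assumes \<rho>: "0 < \<rho>" "\<rho> < 1" and q: "weights \<beta> q"
  shows "(\<rho>, \<beta>) \<in> pQ_dom n x" "ereal (part \<rho> + loglik \<beta> q / total n) \<le> pq \<rho> \<beta>"
proof -
  obtain G where G: "G \<in> feasible n x \<beta>" "\<And>v. v \<in> obs ` idx \<Longrightarrow> pmf G v = q v"
    using weights_feasible[OF q] by blast
  then show "(\<rho>, \<beta>) \<in> pQ_dom n x" using \<rho> by (auto simp: pQ_dom_def)
  have "Q n x lam gam rho0 \<rho>t \<beta>t \<rho> \<beta> G = ereal (part \<rho> + loglik \<beta> q / total n)"
    using q G(2) loglik_cong[of "pmf G" q] by (auto simp: Q_eq[OF \<rho>] weights_def)
  then show "ereal (part \<rho> + loglik \<beta> q / total n) \<le> pq \<rho> \<beta>"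
    unfolding pQ_def using SUP_upper[OF G(1), of "Q n x lam gam rho0 \<rho>t \<beta>t \<rho> \<beta>"] by simp
qed

section \<open>Transfer of maximizers\<close>

text \<open>Local maximality forces stationarity, so the bound of \<open>pQ_le\<close> is attained
  at \<open>(\<rho>n, \<beta>)\<close>; competitors only have to respect that bound. The set
  \<open>U\<close> covers the local and the global case alike.\<close>

lemma dual_max_imp_pQ_max:
  assumes U: "open U" "\<beta> \<in> U" and max: "\<And>z. z \<in> U \<Longrightarrow> dual z \<le> dual \<beta>"
  shows "(\<rho>n, \<beta>) \<in> pQ_dom n x"
    and "(r, z) \<in> pQ_dom n x \<Longrightarrow> z \<in> U \<Longrightarrow> pq r z \<le> pq \<rho>n \<beta>"
proof -
  note st = stationary_attains[OF local_max_stationary[OF U max]]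
  show "(\<rho>n, \<beta>) \<in> pQ_dom n x" using pQ_ge(1)[OF rho_next_bounds st(1)] .
  assume z: "(r, z) \<in> pQ_dom n x" "z \<in> U"
  then have r: "0 < r" "r < 1" by (auto simp: pQ_dom_def)
  have "pq r z \<le> ereal (part r + (dual z + entropy) / total n)" by (rule pQ_le[OF r])
  also have "\<dots> \<le> ereal (part \<rho>n + (dual \<beta> + entropy) / total n)"
    using part_le_rho_next[OF r] max[OF z(2)] total_pos
    by (auto intro!: add_mono divide_right_mono)
  also have "\<dots> \<le> pq \<rho>n \<beta>" using pQ_ge(2)[OF rho_next_bounds st(1)] st(2) by simp
  finally show "pq r z \<le> pq \<rho>n \<beta>" .
qed

text \<open>If some \<open>z\<close> had a larger dual value, weights attaining an even better one
  would exist at some \<open>\<beta>1\<close>, and by concavity a short move from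
  \<open>\<beta>\<close> towards \<open>\<beta>1\<close> would already increase the profile.\<close>

lemma pQ_local_max_imp_dual_max:
  assumes V: "open V" "(\<rho>n, \<beta>) \<in> V" and dom: "(\<rho>n, \<beta>) \<in> pQ_dom n x"
    and max: "\<And>r z. (r, z) \<in> pQ_dom n x \<Longrightarrow> (r, z) \<in> V \<Longrightarrow> pq r z \<le> pq \<rho>n \<beta>"
  shows "dual z \<le> dual \<beta>"
proof (rule ccontr)
  assume "\<not> dual z \<le> dual \<beta>"
  \<comment> \<open>Replacing the intercept of \<open>z\<close> by a stationary one does not lower
    \<open>dual\<close> and makes its value attainable by weights.\<close>
  obtain b where b: "stationary (b, snd z)" using stationary_exists by blast
  define \<beta>1 where "\<beta>1 = (b, snd z)"
  define q1 where "q1 v = freq v / den \<beta>1 v" for v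
  have q1: "weights \<beta>1 q1" "loglik \<beta>1 q1 = dual \<beta>1 + entropy"
    unfolding q1_def[abs_def] \<beta>1_def using stationary_attains[OF b] by auto
  have "dual z \<le> dual \<beta>1"
    using stationary_dual_max[OF b, of "fst z"] by (simp add: \<beta>1_def)
  with \<open>\<not> dual z \<le> dual \<beta>\<close> have better: "dual \<beta> < dual \<beta>1" by simp
  obtain e where e: "0 < e" "ball (\<rho>n, \<beta>) e \<subseteq> V" using V open_contains_ball by blast
  have nearby: "ereal (part \<rho>n + loglik \<beta>' q / total n) \<le> pq \<rho>n \<beta>"
    if "weights \<beta>' q" "dist \<beta>' \<beta> < e" for \<beta>' q
  proof -
    have "(\<rho>n, \<beta>') \<in> ball (\<rho>n, \<beta>) e" using that by (simp add: dist_Pair_Pair dist_commute)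
    then have "(\<rho>n, \<beta>') \<in> V" using e by blast
    then show ?thesis
      using max pQ_ge[OF rho_next_bounds that(1)] order_trans by blast
  qed
  obtain G where "G \<in> feasible n x \<beta>" using dom by (auto simp: pQ_dom_def)
  then have "\<exists>\<beta>' q'. weights \<beta>' q' \<and> dist \<beta>' \<beta> < e"
    using finite_P e(1)
    by (intro positive_weights_nearby[of "pmf G"]) (auto simp: feasible_iff sum_pmf_eq_1)
  then have "pq \<rho>n \<beta> \<noteq> - \<infinity>" using nearby by fastforce
  moreover have le: "pq \<rho>n \<beta> \<le> ereal (part \<rho>n + (dual \<beta> + entropy) / total n)"
    by (rule pQ_le[OF rho_next_bounds])
  ultimately obtain p where p: "pq \<rho>n \<beta> = ereal p" by (cases "pq \<rho>n \<beta>") auto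
  \<comment> \<open>The log-likelihood level corresponding to the profile value at
    \<open>\<beta>\<close>.\<close>
  define r where "r = (p - part \<rho>n) * total n"
  have p_r: "p = part \<rho>n + r / total n" using total_pos by (simp add: r_def)
  have "r \<le> dual \<beta> + entropy"
    using le total_pos by (simp add: p p_r divide_le_cancel)
  then have "r < loglik \<beta>1 q1" using better q1(2) by simp
  from improve_nearby[OF q1(1) this e(1), of \<beta>] obtain \<delta> where \<delta>: "0 < \<delta>"
    "\<And>q0. weights \<beta> q0 \<Longrightarrow> r - \<delta> < loglik \<beta> q0 \<Longrightarrow>
      \<exists>\<beta>' q. weights \<beta>' q \<and> dist \<beta>' \<beta> < e \<and> r < loglik \<beta>' q" by blast
  \<comment> \<open>A distribution within \<open>\<delta>\<close> of the supremum replaces an exact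
    maximizer.\<close>
  have "ereal (part \<rho>n + (r - \<delta>) / total n) < pq \<rho>n \<beta>"
    using \<delta>(1) total_pos by (simp add: p p_r divide_strict_right_mono)
  then obtain G where G: "G \<in> feasible n x \<beta>"
    "ereal (part \<rho>n + (r - \<delta>) / total n) < Q n x lam gam rho0 \<rho>t \<beta>t \<rho>n \<beta> G"
    unfolding pQ_def by (auto simp: less_SUP_iff)
  then have "\<not> (\<exists>v\<in>obs ` idx. pmf G v = 0)" "r - \<delta> < loglik \<beta> (pmf G)"
    using total_pos by (auto simp: Q_eq[OF rho_next_bounds] divide_less_cancel split: if_splits)
  from \<delta>(2)[OF feasible_weights[OF G(1) this(1)] this(2)] obtain \<beta>' q where
    "weights \<beta>' q" "dist \<beta>' \<beta> < e" "r < loglik \<beta>' q" by blast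
  with nearby[of \<beta>' q] show False
    using total_pos by (simp add: p p_r divide_le_cancel)
qed

lemma kappaQ_le_iff:
  "kappaQ n x lam gam rho0 \<rho>t \<beta>t \<rho>n z \<alpha>n \<le> kappaQ n x lam gam rho0 \<rho>t \<beta>t \<rho>n \<beta> \<alpha>n
    \<longleftrightarrow> dual z \<le> dual \<beta>"
  using total_pos by (simp add: kappaQ_eq[OF rho_next_bounds] divide_le_cancel)

lemma local_max_kappaQ_iff:
  "local_maximizer_on UNIV (\<lambda>\<beta>. kappaQ n x lam gam rho0 \<rho>t \<beta>t \<rho>n \<beta> \<alpha>n) \<beta>
    \<longleftrightarrow> (\<exists>U. open U \<and> \<beta> \<in> U \<and> (\<forall>z\<in>U. dual z \<le> dual \<beta>))"
  unfolding local_maximizer_on_def is_arg_max_linorder kappaQ_le_iff by (simp add: Ball_def)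

lemma global_max_kappaQ_iff:
  "global_maximizer_on UNIV (\<lambda>\<beta>. kappaQ n x lam gam rho0 \<rho>t \<beta>t \<rho>n \<beta> \<alpha>n) \<beta>
    \<longleftrightarrow> (\<forall>z. dual z \<le> dual \<beta>)"
  unfolding global_maximizer_on_def is_arg_max_linorder kappaQ_le_iff by simp

lemma local_max_pQ_iff:
  "local_maximizer_on (pQ_dom n x) (\<lambda>(\<rho>, \<beta>). pq \<rho> \<beta>) (\<rho>n, \<beta>)
    \<longleftrightarrow> (\<rho>n, \<beta>) \<in> pQ_dom n x \<and> (\<exists>V. open V \<and> (\<rho>n, \<beta>) \<in> V \<and>
      (\<forall>r z. (r, z) \<in> pQ_dom n x \<and> (r, z) \<in> V \<longrightarrow> pq r z \<le> pq \<rho>n \<beta>))"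
  unfolding local_maximizer_on_def is_arg_max_linorder split_paired_All by simp blast

lemma global_max_pQ_iff:
  "global_maximizer_on (pQ_dom n x) (\<lambda>(\<rho>, \<beta>). pq \<rho> \<beta>) (\<rho>n, \<beta>)
    \<longleftrightarrow> (\<rho>n, \<beta>) \<in> pQ_dom n x \<and> (\<forall>r z. (r, z) \<in> pQ_dom n x \<longrightarrow> pq r z \<le> pq \<rho>n \<beta>)"
  unfolding global_maximizer_on_def is_arg_max_linorder split_paired_All by simp

lemma local_max_dual_imp_local_max_pQ:
  assumes "\<exists>U. open U \<and> \<beta> \<in> U \<and> (\<forall>z\<in>U. dual z \<le> dual \<beta>)"
  shows "local_maximizer_on (pQ_dom n x) (\<lambda>(\<rho>, \<beta>). pq \<rho> \<beta>) (\<rho>n, \<beta>)"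
proof -
  obtain U where U: "open U" "\<beta> \<in> U" "\<And>z. z \<in> U \<Longrightarrow> dual z \<le> dual \<beta>" using assms by blast
  \<comment> \<open>\<open>\<rho>\<close> may range freely, since \<open>\<rho>n\<close> maximizes
    \<open>part\<close> over all of (0,1).\<close>
  have "open (UNIV \<times> U)" "(\<rho>n, \<beta>) \<in> UNIV \<times> U" using U by (simp_all add: open_Times)
  moreover have "\<forall>r z. (r, z) \<in> pQ_dom n x \<and> (r, z) \<in> UNIV \<times> U \<longrightarrow> pq r z \<le> pq \<rho>n \<beta>"
    using dual_max_imp_pQ_max(2)[OF U] by simp
  ultimately show ?thesis
    unfolding local_max_pQ_iff using dual_max_imp_pQ_max(1)[OF U] by blast
qed

lemma global_max_dual_imp_global_max_pQ:
  assumes "\<forall>z. dual z \<le> dual \<beta>"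
  shows "global_maximizer_on (pQ_dom n x) (\<lambda>(\<rho>, \<beta>). pq \<rho> \<beta>) (\<rho>n, \<beta>)"
proof -
  have max: "dual z \<le> dual \<beta>" if "z \<in> UNIV" for z using assms ..
  show ?thesis
    unfolding global_max_pQ_iff
    using dual_max_imp_pQ_max[OF open_UNIV UNIV_I max] by simp
qed

lemma local_max_pQ_imp_global_max_dual:
  assumes "local_maximizer_on (pQ_dom n x) (\<lambda>(\<rho>, \<beta>). pq \<rho> \<beta>) (\<rho>n, \<beta>)"
  shows "\<forall>z. dual z \<le> dual \<beta>"
proof
  fix z
  obtain V where V: "open V" "(\<rho>n, \<beta>) \<in> V" "(\<rho>n, \<beta>) \<in> pQ_dom n x"
    "\<And>r z. (r, z) \<in> pQ_dom n x \<Longrightarrow> (r, z) \<in> V \<Longrightarrow> pq r z \<le> pq \<rho>n \<beta>"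
    using assms unfolding local_max_pQ_iff by blast
  show "dual z \<le> dual \<beta>" by (rule pQ_local_max_imp_dual_max[OF V])
qed

text \<open>All four properties are equivalent: a local maximizer of the profile is a global one of
  \<open>kappaQ\<close>, which closes the cycle of implications.\<close>

lemma maximizers_iff:
  "(local_maximizer_on UNIV (\<lambda>\<beta>. kappaQ n x lam gam rho0 \<rho>t \<beta>t \<rho>n \<beta> \<alpha>n) \<beta>'
      \<longleftrightarrow> local_maximizer_on (pQ_dom n x) (\<lambda>(\<rho>, \<beta>). pq \<rho> \<beta>) (\<rho>n, \<beta>'))
    \<and> (global_maximizer_on UNIV (\<lambda>\<beta>. kappaQ n x lam gam rho0 \<rho>t \<beta>t \<rho>n \<beta> \<alpha>n) \<beta>'
      \<longleftrightarrow> global_maximizer_on (pQ_dom n x) (\<lambda>(\<rho>, \<beta>). pq \<rho> \<beta>) (\<rho>n, \<beta>'))"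
    (is "(?lk \<longleftrightarrow> ?lp) \<and> (?gk \<longleftrightarrow> ?gp)")
proof -
  have "?lk \<Longrightarrow> ?lp"
    unfolding local_max_kappaQ_iff by (rule local_max_dual_imp_local_max_pQ)
  moreover have "?gk \<Longrightarrow> ?gp"
    unfolding global_max_kappaQ_iff by (rule global_max_dual_imp_global_max_pQ)
  moreover have "?lp \<Longrightarrow> ?gk"
    unfolding global_max_kappaQ_iff by (rule local_max_pQ_imp_global_max_dual)
  moreover have "?gp \<Longrightarrow> ?lp"
    unfolding local_max_pQ_iff global_max_pQ_iff by (intro conjI exI[of _ UNIV]) simp_all
  moreover have "?gk \<Longrightarrow> ?lk"
    unfolding local_max_kappaQ_iff global_max_kappaQ_iff by (intro exI[of _ UNIV]) simp
  ultimately show ?thesis by argo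
qed

end

theorem proposition4:
  fixes n :: "nat \<Rightarrow> nat" and x :: "nat \<Rightarrow> nat \<Rightarrow> real ^ 'p"
    and lam gam rho0 \<rho>t :: real and \<beta>t \<beta>' :: "real \<times> (real ^ 'p)"
  assumes "\<And>j. j \<in> {1..3} \<Longrightarrow> n j \<ge> 1"
    and "lam \<ge> 0" and "gam \<ge> 0" and "rho0 \<in> {0<..<1}" and "\<rho>t \<in> {0<..<1}"
  shows
    "(local_maximizer_on UNIV
        (\<lambda>\<beta>. kappaQ n x lam gam rho0 \<rho>t \<beta>t
                (rho_next n x gam rho0 \<rho>t \<beta>t) \<beta> (alpha_next n x \<rho>t \<beta>t)) \<beta>'
      \<longleftrightarrow>
      local_maximizer_on (pQ_dom n x)
        (\<lambda>(\<rho>, \<beta>). pQ n x lam gam rho0 \<rho>t \<beta>t \<rho> \<beta>) (rho_next n x gam rho0 \<rho>t \<beta>t, \<beta>'))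
     \<and>
     (global_maximizer_on UNIV
        (\<lambda>\<beta>. kappaQ n x lam gam rho0 \<rho>t \<beta>t
                (rho_next n x gam rho0 \<rho>t \<beta>t) \<beta> (alpha_next n x \<rho>t \<beta>t)) \<beta>'
      \<longleftrightarrow>
      global_maximizer_on (pQ_dom n x)
        (\<lambda>(\<rho>, \<beta>). pQ n x lam gam rho0 \<rho>t \<beta>t \<rho> \<beta>) (rho_next n x gam rho0 \<rho>t \<beta>t, \<beta>'))"
proof -
  interpret em_step n x lam gam rho0 \<rho>t \<beta>t
    by (rule em_step.intro) (fact assms)+
  show ?thesis by (rule maximizers_iff)
qed

end
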